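(* Let $n \geqslant m \geqslant 1$ be integers and let $\sigma^m = [\upsilon^0, \upsilon^1, \ldots, \upsilon^m]$ be an $m$-simplex in $\mathbb{R}^n$ with barycenter $\kappa^m$. Then the barycentric circumradius $\beta_{\rm cir}^m$ of $\sigma^m$ is unique, it is given by $$\beta_{\rm cir}^m = \frac{1}{m+1}\max_{0\leqslant i\leqslant m}\Biggl\{m\sum_{\substack{j=0\\ j\neq i}}^{m} \|\upsilon^i-\upsilon^j\|^2 - \sum_{\substack{p=0\\ p\neq i}}^{m-1}\ \sum_{\substack{q=p+1\\ q\neq i}}^{m} \|\upsilon^p-\upsilon^q\|^2\Biggr\}^{1/2},$$ and the spherical surface with center $\kappa^m$ and radius $\beta_{\rm cir}^m$ encloses $\sigma^m$.
   Context: An $m$-simplex $[\upsilon^0,\ldots,\upsilon^m]$ in $\mathbb{R}^n$ is the convex hull of $m+1$ affinely independent points (its vertices). Its barycenter is $\kappa^m=\frac1{m+1}\sum_{j=0}^m\upsilon^j$. A spherical surface (the boundary of a closed Euclidean ball in $\mathbb{R}^n$) encloses a set if the closed ball it bounds contains the set. The barycentric circumradius $\beta_{\rm cir}^m$ is the smallest radius of a spherical surface centered at $\kappa^m$ that encloses $\sigma^m$. $\|\cdot\|$ is the Euclidean norm. *)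

theory Defs
  imports "HOL-Analysis.Analysis"
begin

definition is_simplex_vertices :: "nat \<Rightarrow> (nat \<Rightarrow> 'a::euclidean_space) \<Rightarrow> bool" where
  "is_simplex_vertices m v \<longleftrightarrow> inj_on v {0..m} \<and> \<not> affine_dependent (v ` {0..m})"

definition simplex_of :: "nat \<Rightarrow> (nat \<Rightarrow> 'a::euclidean_space) \<Rightarrow> 'a set" where
  "simplex_of m v = convex hull (v ` {0..m})"

definition barycenter :: "nat \<Rightarrow> (nat \<Rightarrow> 'a::euclidean_space) \<Rightarrow> 'a" where
  "barycenter m v = (1 / (real m + 1)) *\<^sub>R (\<Sum>j=0..m. v j)"

(* Balls are non-degenerate, so S determines c and r, and "the closed ball bounded by S"
   is unambiguous. *)
definition encloses :: "'a::euclidean_space set \<Rightarrow> 'a set \<Rightarrow> bool" where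
  "encloses S A \<longleftrightarrow> (\<exists>c r. 0 < r \<and> S = sphere c r \<and> A \<subseteq> cball c r)"

(* A predicate rather than a function: that a smallest radius exists, and is unique,
   is part of what has to be proved. *)
definition is_barycentric_circumradius ::
    "nat \<Rightarrow> (nat \<Rightarrow> 'a::euclidean_space) \<Rightarrow> real \<Rightarrow> bool" where
  "is_barycentric_circumradius m v \<beta> \<longleftrightarrow>
     0 < \<beta> \<and> encloses (sphere (barycenter m v) \<beta>) (simplex_of m v) \<and>
     (\<forall>r. 0 < r \<and> encloses (sphere (barycenter m v) r) (simplex_of m v) \<longrightarrow> \<beta> \<le> r)"

end

theory Submission imports Defs begin

text \<open>
  With \<open>w\<^sub>j = v\<^sub>i - v\<^sub>j\<close> one has \<open>(m + 1) (v\<^sub>i - \<kappa>) = \<Sum>\<^sub>j w\<^sub>j\<close>. Lagrange's identity for the squared norm of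
  this sum gives the expression in braces as \<open>(m + 1)\<^sup>2 \<parallel>v\<^sub>i - \<kappa>\<parallel>\<^sup>2\<close>. Balls being convex, the smallest
  radius is the largest distance from \<open>\<kappa>\<close> to a vertex.
\<close>

text \<open>Induction inserting indices in increasing order: a new largest \<open>b\<close> adds
  exactly the pairs \<open>(p, b)\<close> with \<open>p\<close> in \<open>A\<close>. Expanding their
  squared distances produces the cross term \<open>2 * ((\<Sum>p\<in>A. w p) \<bullet> w b)\<close>
  that also arises from the norm of the enlarged sum.\<close>

lemma norm_sum_Lagrange:
  fixes w :: "nat \<Rightarrow> 'a::real_inner"
  assumes "finite S"
  shows "(norm (\<Sum>j\<in>S. w j))\<^sup>2 =
    real (card S) * (\<Sum>j\<in>S. (norm (w j))\<^sup>2) - (\<Sum>p\<in>S. \<Sum>q\<in>{q\<in>S. p < q}. (norm (w p - w q))\<^sup>2)"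
  using assms
proof (induction S rule: finite_linorder_max_induct)
  case empty
  then show ?case by simp
next
  case (insert b A)
  have b: "b \<notin> A" using insert.hyps by auto
  have above: "{q \<in> insert b A. p < q} = insert b {q\<in>A. p < q}" if "p \<in> A" for p
    using that insert.hyps by auto
  have none: "{q \<in> insert b A. b < q} = {}"
    using insert.hyps by auto
  have "(\<Sum>p\<in>insert b A. \<Sum>q\<in>{q\<in>insert b A. p < q}. (norm (w p - w q))\<^sup>2) =
      (\<Sum>p\<in>A. (norm (w p - w b))\<^sup>2 + (\<Sum>q\<in>{q\<in>A. p < q}. (norm (w p - w q))\<^sup>2))"
    unfolding sum.insert[OF insert.hyps(1) b] none sum.empty add_0_left
  proof (rule sum.cong[OF refl])
    fix p assume "p \<in> A"
    show "(\<Sum>q\<in>{q\<in>insert b A. p < q}. (norm (w p - w q))\<^sup>2) =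
        (norm (w p - w b))\<^sup>2 + (\<Sum>q\<in>{q\<in>A. p < q}. (norm (w p - w q))\<^sup>2)"
      unfolding above[OF \<open>p \<in> A\<close>] using insert.hyps(1) b by simp
  qed
  moreover have "(\<Sum>p\<in>A. (norm (w p - w b))\<^sup>2) =
      (\<Sum>p\<in>A. (norm (w p))\<^sup>2) + card A * (norm (w b))\<^sup>2 - 2 * ((\<Sum>p\<in>A. w p) \<bullet> w b)"
    by (simp add: power2_norm_eq_inner inner_diff_left inner_diff_right inner_commute
        sum.distrib sum_subtractf inner_sum_right flip: sum_distrib_left)
  moreover have "(norm (\<Sum>j\<in>insert b A. w j))\<^sup>2 =
      (norm (w b))\<^sup>2 + (norm (\<Sum>j\<in>A. w j))\<^sup>2 + 2 * ((\<Sum>p\<in>A. w p) \<bullet> w b)"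
    using insert.hyps b
    by (simp add: power2_norm_eq_inner inner_add_left inner_add_right inner_commute)
  ultimately show ?case
    using insert.IH insert.hyps(1) b by (simp add: sum.distrib algebra_simps)
qed

text \<open>The line through both centers meets the first sphere in two points, at distances
  \<open>\<bar>r - D\<bar>\<close> and \<open>r + D\<close> from \<open>d\<close>, where
  \<open>D = norm (d - c)\<close>. Both equal \<open>s\<close> only if \<open>D = 0\<close>. This
  rids \<open>encloses\<close> of its existential quantifiers.\<close>

lemma sphere_eq_sphere_iff:
  fixes c d :: "'a::euclidean_space"
  assumes "0 < r" "0 < s"
  shows "sphere c r = sphere d s \<longleftrightarrow> c = d \<and> r = s"
proof
  assume eq: "sphere c r = sphere d s"
  have on_line: "\<bar>t - norm (d - c)\<bar> = s" if "\<bar>t\<bar> = r" "norm u = 1" "norm (d - c) *\<^sub>R u = d - c" for t u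
  proof -
    have "c + t *\<^sub>R u \<in> sphere c r" using that by (simp add: dist_norm)
    then have "norm (d - (c + t *\<^sub>R u)) = s" using eq by (simp add: dist_norm)
    moreover have "d - (c + t *\<^sub>R u) = (norm (d - c) - t) *\<^sub>R u"
      using that(3) by (simp add: algebra_simps)
    ultimately show ?thesis using that(2) by simp
  qed
  obtain e :: 'a where e: "norm e = 1"
    using norm_Basis nonempty_Basis by blast
  \<comment> \<open>For equal centers \<open>sgn (d - c)\<close> is zero and gives no direction; any
    unit vector serves then.\<close>
  define u where "u = (if d = c then e else sgn (d - c))"
  have u: "norm u = 1" "norm (d - c) *\<^sub>R u = d - c"
    using e by (auto simp: u_def norm_sgn sgn_div_norm)
  have "\<bar>r - norm (d - c)\<bar> = s" "\<bar>- r - norm (d - c)\<bar> = s"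
    using on_line[OF _ u] assms by auto
  then have "norm (d - c) = 0" "r = s"
    using assms norm_ge_zero[of "d - c"] by linarith+
  then show "c = d \<and> r = s" by simp
qed simp

lemma encloses_sphere_iff:
  assumes "0 < r"
  shows "encloses (sphere c r) A \<longleftrightarrow> A \<subseteq> cball c r"
  using assms by (auto simp: encloses_def sphere_eq_sphere_iff)

text \<open>The positive radii that enclose the simplex are exactly those at least \<open>R\<close>,
  and \<open>R\<close> is itself positive, so it is the least of them.\<close>

lemma is_barycentric_circumradius_iff:
  fixes v :: "nat \<Rightarrow> 'a::euclidean_space"
  assumes "1 \<le> m" "is_simplex_vertices m v"
  shows "is_barycentric_circumradius m v \<beta> \<longleftrightarrow>
    \<beta> = Max ((\<lambda>i. dist (barycenter m v) (v i)) ` {0..m})"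
proof -
  define R where "R = Max ((\<lambda>i. dist (barycenter m v) (v i)) ` {0..m})"
  have enc: "encloses (sphere (barycenter m v) r) (simplex_of m v) \<longleftrightarrow> R \<le> r" if "0 < r" for r
  proof -
    have "simplex_of m v \<subseteq> cball (barycenter m v) r \<longleftrightarrow> v ` {0..m} \<subseteq> cball (barycenter m v) r"
      unfolding simplex_of_def
      by (meson convex_cball hull_minimal hull_subset subset_trans)
    then show ?thesis
      using that by (auto simp: encloses_sphere_iff R_def)
  qed
  \<comment> \<open>Two distinct vertices cannot both lie at the barycenter, which makes
    \<open>R\<close> positive and thus an admissible radius.\<close>
  have "v 0 \<noteq> v 1"
    using assms inj_onD[of v "{0..m}" 0 1] by (auto simp: is_simplex_vertices_def)
  then have "\<exists>i\<in>{0..m}. 0 < dist (barycenter m v) (v i)"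
    using assms(1) by (metis atLeastAtMost_iff le0 zero_less_dist_iff)
  then have "0 < R"
    by (simp add: R_def Max_gr_iff)
  then show ?thesis
    unfolding is_barycentric_circumradius_def R_def[symmetric]
    using enc by (metis order_antisym order_refl)
qed

text \<open>The Lagrange identity is applied to the \<open>m\<close> vectors
  \<open>v i - v j\<close> with \<open>j \<noteq> i\<close>; in their pairwise differences
  \<open>v i\<close> cancels.\<close>

lemma dist_barycenter_vertex:
  fixes v :: "nat \<Rightarrow> 'a::euclidean_space"
  assumes "1 \<le> m" "i \<le> m"
  shows "dist (barycenter m v) (v i) = 1 / (real m + 1) *
    sqrt (real m * (\<Sum>j\<in>{0..m} - {i}. (norm (v i - v j))\<^sup>2)
      - (\<Sum>p\<in>{0..m - 1} - {i}. \<Sum>q\<in>{p + 1..m} - {i}. (norm (v p - v q))\<^sup>2))"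
proof -
  let ?S = "{0..m} - {i}"
  \<comment> \<open>Only \<open>p = m\<close> can be lost here, and no \<open>q\<close> lies above
    it.\<close>
  have "(\<Sum>p\<in>?S. \<Sum>q\<in>{q\<in>?S. p < q}. (norm (v p - v q))\<^sup>2) =
      (\<Sum>p\<in>{0..m - 1} - {i}. \<Sum>q\<in>{q\<in>?S. p < q}. (norm (v p - v q))\<^sup>2)"
    by (rule sum.mono_neutral_right) (auto intro!: sum.neutral)
  also have "\<dots> = (\<Sum>p\<in>{0..m - 1} - {i}. \<Sum>q\<in>{p + 1..m} - {i}. (norm (v p - v q))\<^sup>2)"
    by (intro sum.cong refl) auto
  finally have "(norm (\<Sum>j\<in>?S. v i - v j))\<^sup>2 = real m * (\<Sum>j\<in>?S. (norm (v i - v j))\<^sup>2)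
      - (\<Sum>p\<in>{0..m - 1} - {i}. \<Sum>q\<in>{p + 1..m} - {i}. (norm (v p - v q))\<^sup>2)"
    using assms by (simp add: norm_sum_Lagrange norm_minus_commute)
  moreover have "v i - barycenter m v = (1 / (real m + 1)) *\<^sub>R (\<Sum>j\<in>?S. v i - v j)"
  proof -
    \<comment> \<open>The added term \<open>j = i\<close> is zero.\<close>
    have "(\<Sum>j\<in>?S. v i - v j) = (\<Sum>j=0..m. v i - v j)"
      by (rule sum.mono_neutral_left) auto
    also have "\<dots> = (real m + 1) *\<^sub>R v i - (\<Sum>j=0..m. v j)"
      by (simp add: sum_subtractf sum_constant_scaleR add.commute)
    finally show ?thesis
      by (simp add: barycenter_def scaleR_diff_right)
  qed
  moreover have "norm (\<Sum>j\<in>?S. v i - v j) = sqrt ((norm (\<Sum>j\<in>?S. v i - v j))\<^sup>2)"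
    by simp
  ultimately show ?thesis
    by (simp add: dist_norm norm_minus_commute[of "barycenter m v" "v i"])
qed

theorem theorem3p3:
  fixes v :: "nat \<Rightarrow> real ^ 'n" and m :: nat
  assumes "1 \<le> m" and "m \<le> CARD('n)"
    and "is_simplex_vertices m v"
  shows "(\<exists>!\<beta>. is_barycentric_circumradius m v \<beta>) \<and>
    (\<forall>\<beta>. is_barycentric_circumradius m v \<beta> \<longrightarrow>
       \<beta> = 1 / (real m + 1) *
         Max ((\<lambda>i. sqrt (real m * (\<Sum>j\<in>{0..m} - {i}. (norm (v i - v j))\<^sup>2)
                - (\<Sum>p\<in>{0..m - 1} - {i}. \<Sum>q\<in>{p + 1..m} - {i}. (norm (v p - v q))\<^sup>2)))
              ` {0..m}) \<and>
       encloses (sphere (barycenter m v) \<beta>) (simplex_of m v))"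
proof -
  let ?f = "\<lambda>i. sqrt (real m * (\<Sum>j\<in>{0..m} - {i}. (norm (v i - v j))\<^sup>2)
      - (\<Sum>p\<in>{0..m - 1} - {i}. \<Sum>q\<in>{p + 1..m} - {i}. (norm (v p - v q))\<^sup>2))"
  have "(\<lambda>i. dist (barycenter m v) (v i)) ` {0..m} = (\<lambda>x. 1 / (real m + 1) * x) ` ?f ` {0..m}"
    unfolding image_image using assms(1) by (intro image_cong refl) (simp add: dist_barycenter_vertex)
  \<comment> \<open>The common factor is nonnegative, so it may be pulled out of the
    maximum.\<close>
  moreover have "mono (\<lambda>x. 1 / (real m + 1) * x)"
    by (intro monoI mult_left_mono) auto
  then have "1 / (real m + 1) * Max (?f ` {0..m}) = Max ((\<lambda>x. 1 / (real m + 1) * x) ` ?f ` {0..m})"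
    by (rule mono_Max_commute) auto
  ultimately have "Max ((\<lambda>i. dist (barycenter m v) (v i)) ` {0..m}) =
      1 / (real m + 1) * Max (?f ` {0..m})"
    by (simp only:)
  \<comment> \<open>Being equivalent to equality with one fixed number, the predicate yields
    existence, uniqueness and the formula together.\<close>
  then have iff: "is_barycentric_circumradius m v \<beta> \<longleftrightarrow>
      \<beta> = 1 / (real m + 1) * Max (?f ` {0..m})" for \<beta>
    using is_barycentric_circumradius_iff[OF assms(1,3)] by simp
  then have "\<exists>!\<beta>. is_barycentric_circumradius m v \<beta>"
    by simp
  moreover have "encloses (sphere (barycenter m v) \<beta>) (simplex_of m v)"
    if "is_barycentric_circumradius m v \<beta>" for \<beta>
    using that by (simp add: is_barycentric_circumradius_def)
  ultimately show ?thesis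
    using iff by blast
qed

end
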